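(* Let $W_1 := X_{x_3}$ and $W_2 := X_{x_1}+X_{x_1^2-x_2^2}+G_{x_3}$, viewed as algebraic vector fields on the unit sphere $S^2\subset\mathbb{R}^3$. Then $\operatorname{Lie}_{\mathbb{R}}\{W_1,W_2\}=\mathfrak{X}_{\mathrm{alg}}(S^2)$, i.e. the real Lie subalgebra generated by $W_1$ and $W_2$ is the whole Lie algebra of algebraic vector fields on $S^2$.
   Context: $S^2=\{x\in\mathbb{R}^3 : \|x\|_2=1\}$. A (tangent) vector field on $S^2$ is algebraic if it is the restriction to $S^2$ of a polynomial vector field on $\mathbb{R}^3$; $\mathfrak{X}_{\mathrm{alg}}(S^2)$ denotes the real Lie algebra of these fields, with bracket $[U,V](f)=U(V(f))-V(U(f))$. Equivalently, with $\mathcal{O}=\mathbb{R}[x_1,x_2,x_3]/(x\cdot x-1)$ the algebra of polynomial functions on $S^2$, $\mathfrak{X}_{\mathrm{alg}}(S^2)=\{U\in\mathcal{O}^3 : x\cdot U=0\}$. For a polynomial $f\in\mathbb{R}[x_1,x_2,x_3]$, define vector fields on $S^2$ by $X_f(x):=x\times\nabla f(x)$ and $G_f(x):=\nabla f(x)-(x\cdot\nabla f(x))\,x$, where $\nabla$ is the Euclidean gradient in $\mathbb{R}^3$. $\operatorname{Lie}_{\mathbb{R}}\{U_1,\dots,U_m\}$ denotes the smallest real Lie subalgebra of $\mathfrak{X}_{\mathrm{alg}}(S^2)$ containing $U_1,\dots,U_m$. *)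

theory Defs
  imports "HOL-Analysis.Analysis"
begin

text \<open>
  A function or vector field on the sphere is an extensional function on \<open>S2\<close> (library
  \<^const>\<open>restrict\<close>): its value off the sphere is the fixed junk value \<^const>\<open>undefined\<close>, so
  HOL equality is equality on the sphere.
\<close>

abbreviation S2 :: "(real^3) set"
  where "S2 \<equiv> sphere 0 1"

definition alg_functions :: "(real^3 \<Rightarrow> real) set"
  where "alg_functions = {restrict p S2 |p. real_polynomial_function p}"

definition alg_vector_fields :: "(real^3 \<Rightarrow> real^3) set"
  where "alg_vector_fields =
    {restrict P S2 |P. polynomial_function P \<and> (\<forall>x\<in>S2. x \<bullet> P x = 0)}"

definition vf_zero :: "real^3 \<Rightarrow> real^3"
  where "vf_zero = (\<lambda>x\<in>S2. 0)"

definition vf_add :: "(real^3 \<Rightarrow> real^3) \<Rightarrow> (real^3 \<Rightarrow> real^3) \<Rightarrow> real^3 \<Rightarrow> real^3"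
  where "vf_add U V = (\<lambda>x\<in>S2. U x + V x)"

definition vf_scale :: "real \<Rightarrow> (real^3 \<Rightarrow> real^3) \<Rightarrow> real^3 \<Rightarrow> real^3"
  where "vf_scale c U = (\<lambda>x\<in>S2. c *\<^sub>R U x)"

text \<open>
  The action \<open>U(f)\<close> of a tangent field on a function on the sphere.  The derivative is taken
  within the sphere, so only the values of \<open>f\<close> on the sphere matter.  As a linear map on the whole
  of \<open>real^3\<close> such a derivative is not unique, but its values on tangent vectors are
  (\<open>derivative_within_S2_unique\<close> below).
\<close>

definition vf_action :: "(real^3 \<Rightarrow> real^3) \<Rightarrow> (real^3 \<Rightarrow> real) \<Rightarrow> real^3 \<Rightarrow> real"
  where "vf_action U f = (\<lambda>x\<in>S2. frechet_derivative f (at x within S2) (U x))"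

text \<open>Existence and uniqueness of the field described here is \<open>lie_bracket_ex1\<close> below.\<close>

definition lie_bracket :: "(real^3 \<Rightarrow> real^3) \<Rightarrow> (real^3 \<Rightarrow> real^3) \<Rightarrow> real^3 \<Rightarrow> real^3"
  where "lie_bracket U V = (THE W. W \<in> alg_vector_fields \<and>
    (\<forall>f\<in>alg_functions. \<forall>x\<in>S2.
       vf_action W f x = vf_action U (vf_action V f) x - vf_action V (vf_action U f) x))"

definition lie_subalgebra :: "(real^3 \<Rightarrow> real^3) set \<Rightarrow> bool"
  where "lie_subalgebra L \<longleftrightarrow>
    L \<subseteq> alg_vector_fields \<and>
    vf_zero \<in> L \<and>
    (\<forall>U\<in>L. \<forall>V\<in>L. vf_add U V \<in> L) \<and>
    (\<forall>c. \<forall>U\<in>L. vf_scale c U \<in> L) \<and>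
    (\<forall>U\<in>L. \<forall>V\<in>L. lie_bracket U V \<in> L)"

definition lie_generated :: "(real^3 \<Rightarrow> real^3) set \<Rightarrow> (real^3 \<Rightarrow> real^3) set"
  where "lie_generated A = lie_subalgebra hull A"

definition gradient :: "(real^3 \<Rightarrow> real) \<Rightarrow> real^3 \<Rightarrow> real^3"
  where "gradient f x = (THE D. GDERIV f x :> D)"

definition X_field :: "(real^3 \<Rightarrow> real) \<Rightarrow> real^3 \<Rightarrow> real^3"
  where "X_field f = (\<lambda>x\<in>S2. cross3 x (gradient f x))"

definition G_field :: "(real^3 \<Rightarrow> real) \<Rightarrow> real^3 \<Rightarrow> real^3"
  where "G_field f = (\<lambda>x\<in>S2. gradient f x - (x \<bullet> gradient f x) *\<^sub>R x)"


subsection \<open>Well-definedness\<close>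

lemma derivative_within_S2_unique:
  fixes f :: "real^3 \<Rightarrow> 'b::real_normed_vector"
  assumes x: "x \<in> S2" and tan: "x \<bullet> v = 0"
    and A: "(f has_derivative A) (at x within S2)"
    and B: "(f has_derivative B) (at x within S2)"
  shows "A v = B v"
proof (cases "v = 0")
  case True
  then show ?thesis
    using A B by (simp add: has_derivative_bounded_linear linear_simps(3))
next
  case False
  define w where "w = sgn v"
  have w: "x \<bullet> w = 0" "norm w = 1" "v = norm v *\<^sub>R w"
    using tan False by (auto simp: w_def sgn_div_norm norm_sgn)
  define c where "c = (\<lambda>t::real. cos t *\<^sub>R x + sin t *\<^sub>R w)"
  have xx: "x \<bullet> x = 1" "w \<bullet> w = 1"
    using x w by (auto simp: dot_square_norm)
  have "c t \<bullet> c t = 1" for t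
  proof -
    have "c t \<bullet> c t = (cos t)\<^sup>2 + (sin t)\<^sup>2"
      using xx w(1) by (simp add: c_def inner_add_left inner_add_right inner_commute power2_eq_square)
    then show ?thesis by simp
  qed
  then have "norm (c t) = 1" for t
    by (simp add: norm_eq_sqrt_inner)
  then have c: "range c \<subseteq> S2" by auto
  have c0: "c 0 = x" by (simp add: c_def)
  have dc: "(c has_derivative (\<lambda>t. t *\<^sub>R w)) (at 0)"
    unfolding c_def by (auto intro!: derivative_eq_intros)
  have "((\<lambda>t. f (c t)) has_derivative (\<lambda>t. A (t *\<^sub>R w))) (at 0)"
    by (rule has_derivative_in_compose[OF dc]) (use A c c0 in \<open>auto intro: has_derivative_subset\<close>)
  moreover have "((\<lambda>t. f (c t)) has_derivative (\<lambda>t. B (t *\<^sub>R w))) (at 0)"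
    by (rule has_derivative_in_compose[OF dc]) (use B c c0 in \<open>auto intro: has_derivative_subset\<close>)
  ultimately have "(\<lambda>t. A (t *\<^sub>R w)) = (\<lambda>t. B (t *\<^sub>R w))"
    by (rule has_derivative_unique)
  from fun_cong[OF this, of "norm v"] show ?thesis
    using w(3) by simp
qed

lemma frechet_derivative_within_S2:
  fixes p :: "real^3 \<Rightarrow> real"
  assumes "x \<in> S2" "x \<bullet> v = 0" "(p has_derivative D) (at x)"
    and "\<And>y. y \<in> S2 \<Longrightarrow> f y = p y"
  shows "frechet_derivative f (at x within S2) v = D v"
proof -
  have "(p has_derivative D) (at x within S2)"
    using assms(3) by (rule has_derivative_at_withinI)
  then have D: "(f has_derivative D) (at x within S2)"
    using assms(1,4) by (rule has_derivative_transform[rotated 2])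
  then have "(f has_derivative frechet_derivative f (at x within S2)) (at x within S2)"
    using frechet_derivative_works differentiable_def by blast
  from derivative_within_S2_unique[OF assms(1,2) this D] show ?thesis .
qed

definition dir_deriv :: "(real^3 \<Rightarrow> real^3) \<Rightarrow> (real^3 \<Rightarrow> real) \<Rightarrow> real^3 \<Rightarrow> real"
  where "dir_deriv P p x = frechet_derivative p (at x) (P x)"

lemma real_polynomial_function_has_derivative:
  assumes "real_polynomial_function (p :: real^3 \<Rightarrow> real)"
  shows "(p has_derivative frechet_derivative p (at x)) (at x)"
  using assms differentiable_at_polynomial_function[of p x] frechet_derivative_works
  by (auto simp: real_polynomial_function_eq)

lemma dir_deriv_eqI: "(p has_derivative D) (at x) \<Longrightarrow> dir_deriv P p x = D (P x)"
  by (metis dir_deriv_def frechet_derivative_at)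

lemma dir_deriv_simps:
  shows "bounded_linear p \<Longrightarrow> dir_deriv P p = (\<lambda>x. p (P x))"
    and "dir_deriv P (\<lambda>x. c) = (\<lambda>x. 0)"
    and "real_polynomial_function p \<Longrightarrow> real_polynomial_function q \<Longrightarrow>
      dir_deriv P (\<lambda>x. p x + q x) = (\<lambda>x. dir_deriv P p x + dir_deriv P q x)"
    and "real_polynomial_function p \<Longrightarrow> real_polynomial_function q \<Longrightarrow>
      dir_deriv P (\<lambda>x. p x * q x) = (\<lambda>x. p x * dir_deriv P q x + dir_deriv P p x * q x)"
proof -
  show "dir_deriv P p = (\<lambda>x. p (P x))" if "bounded_linear p"
    by (rule ext, rule dir_deriv_eqI) (rule bounded_linear_imp_has_derivative[OF that])
  show "dir_deriv P (\<lambda>x. c) = (\<lambda>x. 0)"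
    by (simp add: dir_deriv_def fun_eq_iff)
  assume pq: "real_polynomial_function p" "real_polynomial_function q"
  note d = pq[THEN real_polynomial_function_has_derivative]
  show "dir_deriv P (\<lambda>x. p x + q x) = (\<lambda>x. dir_deriv P p x + dir_deriv P q x)"
    using dir_deriv_eqI[OF has_derivative_add[OF d]] by (auto simp: dir_deriv_def)
  show "dir_deriv P (\<lambda>x. p x * q x) = (\<lambda>x. p x * dir_deriv P q x + dir_deriv P p x * q x)"
    using dir_deriv_eqI[OF has_derivative_mult[OF d]] by (auto simp: dir_deriv_def)
qed

lemma real_polynomial_function_dir_deriv:
  assumes "real_polynomial_function p" "polynomial_function P"
  shows "real_polynomial_function (dir_deriv P p)"
  using assms(1)
proof (induction p rule: real_polynomial_function.induct)
  case (linear f)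
  then show ?case
    using assms(2) by (simp add: dir_deriv_simps polynomial_function_def o_def)
qed (auto simp: dir_deriv_simps)

definition commutator :: "(real^3 \<Rightarrow> real^3) \<Rightarrow> (real^3 \<Rightarrow> real^3) \<Rightarrow> real^3 \<Rightarrow> real^3"
  where "commutator P Q x =
    (\<chi> i. dir_deriv P (\<lambda>y. Q y $ i) x - dir_deriv Q (\<lambda>y. P y $ i) x)"

lemma real_polynomial_function_nth:
  "polynomial_function (P :: real^3 \<Rightarrow> real^3) \<Longrightarrow> real_polynomial_function (\<lambda>y. P y $ i)"
  unfolding polynomial_function_def o_def using bounded_linear_vec_nth by blast

lemma polynomial_functionI_nth:
  assumes "\<And>i. real_polynomial_function (\<lambda>y. (P :: real^3 \<Rightarrow> real^3) y $ i)"
  shows "polynomial_function P"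
  unfolding polynomial_function_iff_Basis_inner
  using assms by (auto simp: Basis_vec_def inner_axis real_polynomial_function_eq)

lemma polynomial_function_commutator:
  assumes "polynomial_function P" "polynomial_function Q"
  shows "polynomial_function (commutator P Q)"
  by (rule polynomial_functionI_nth)
    (auto simp: commutator_def assms
      intro!: real_polynomial_function_diff real_polynomial_function_dir_deriv
        real_polynomial_function_nth)

lemma linear_functional_sum:
  assumes "bounded_linear (f :: real^3 \<Rightarrow> real)"
  shows "f x = (\<Sum>i\<in>UNIV. f (axis i 1) * x $ i)"
proof -
  interpret f: bounded_linear f by fact
  have "f x = f (\<Sum>i\<in>UNIV. x $ i *\<^sub>R axis i 1)"
    by (simp add: basis_expansion flip: scalar_mult_eq_scaleR)
  then show ?thesis
    by (simp add: f.sum f.scaleR mult.commute)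
qed

lemma dir_deriv_commutator:
  assumes P: "polynomial_function P" and Q: "polynomial_function Q"
    and p: "real_polynomial_function p"
  shows "dir_deriv (commutator P Q) p x
    = dir_deriv P (dir_deriv Q p) x - dir_deriv Q (dir_deriv P p) x"
  using p
proof (induction p arbitrary: x rule: real_polynomial_function.induct)
  case (linear f)
  have *: "dir_deriv R (\<lambda>y. f (S y)) x = (\<Sum>i\<in>UNIV. f (axis i 1) * dir_deriv R (\<lambda>y. S y $ i) x)"
    if "polynomial_function S" for R S :: "real^3 \<Rightarrow> real^3"
  proof -
    have "((\<lambda>y. f (S y)) has_derivative
        (\<lambda>h. \<Sum>i\<in>UNIV. f (axis i 1) * frechet_derivative (\<lambda>y. S y $ i) (at x) h)) (at x)"
      unfolding linear_functional_sum[OF linear, of "S _"]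
      by (intro has_derivative_sum has_derivative_mult_right
          real_polynomial_function_has_derivative real_polynomial_function_nth that)
    from dir_deriv_eqI[OF this] show ?thesis by (simp add: dir_deriv_def)
  qed
  have "f (commutator P Q x) = (\<Sum>i\<in>UNIV. f (axis i 1) * commutator P Q x $ i)"
    by (rule linear_functional_sum[OF linear])
  then show ?case
    using linear by (simp add: dir_deriv_simps * P Q commutator_def right_diff_distrib sum_subtractf)
next
  case (const c)
  then show ?case by (simp add: dir_deriv_simps)
next
  case (add f g)
  then show ?case
    by (simp add: dir_deriv_simps real_polynomial_function_dir_deriv P Q)
next
  case (mult f g)
  have "dir_deriv (commutator P Q) (\<lambda>x. f x * g x) x
      = f x * (dir_deriv P (dir_deriv Q g) x - dir_deriv Q (dir_deriv P g) x)
        + (dir_deriv P (dir_deriv Q f) x - dir_deriv Q (dir_deriv P f) x) * g x"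
    by (simp add: dir_deriv_simps mult)
  then show ?case
    by (simp add: dir_deriv_simps real_polynomial_function_dir_deriv P Q mult.hyps
        real_polynomial_function.intros algebra_simps)
qed

lemma vf_action_restrict:
  assumes "real_polynomial_function p" "\<And>x. x \<in> S2 \<Longrightarrow> x \<bullet> P x = 0"
  shows "vf_action (restrict P S2) (restrict p S2) = restrict (dir_deriv P p) S2"
  unfolding vf_action_def dir_deriv_def
  by (rule restrict_ext)
    (use assms in \<open>auto intro!: frechet_derivative_within_S2[of _ _ p] real_polynomial_function_has_derivative\<close>)

lemma commutator_tangent:
  assumes P: "polynomial_function P" "\<And>x. x \<in> S2 \<Longrightarrow> x \<bullet> P x = 0"
    and Q: "polynomial_function Q" "\<And>x. x \<in> S2 \<Longrightarrow> x \<bullet> Q x = 0"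
    and x: "x \<in> S2"
  shows "x \<bullet> commutator P Q x = 0"
proof -
  let ?n = "\<lambda>x::real^3. x \<bullet> x"
  have n: "real_polynomial_function ?n"
    unfolding inner_vec_def
    by (simp, intro real_polynomial_function_sum real_polynomial_function.intros(4)
        real_polynomial_function.intros(1) bounded_linear_vec_nth) simp
  have dn: "dir_deriv R ?n = (\<lambda>x. 2 * (x \<bullet> R x))" for R
    by (auto simp: fun_eq_iff inner_commute intro!: dir_deriv_eqI[THEN trans] derivative_eq_intros)
  have *: "dir_deriv R (dir_deriv T ?n) x = 0"
    if "\<And>x. x \<in> S2 \<Longrightarrow> x \<bullet> R x = 0" "\<And>x. x \<in> S2 \<Longrightarrow> x \<bullet> T x = 0"
      and T: "polynomial_function T" for R T
  proof -
    have "restrict (dir_deriv R (dir_deriv T ?n)) S2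
        = vf_action (restrict R S2) (restrict (dir_deriv T ?n) S2)"
      by (rule vf_action_restrict[OF real_polynomial_function_dir_deriv[OF n T] that(1), symmetric])
    also have "restrict (dir_deriv T ?n) S2 = restrict (\<lambda>x. 0) S2"
      using that(2) by (auto simp: dn intro!: restrict_ext)
    also have "vf_action (restrict R S2) (restrict (\<lambda>x. 0) S2) = restrict (\<lambda>x. 0) S2"
      using that(1) by (subst vf_action_restrict) (auto simp: dir_deriv_simps)
    finally show ?thesis
      using fun_cong[of _ _ x] x by fastforce
  qed
  have "2 * (x \<bullet> commutator P Q x) = dir_deriv (commutator P Q) ?n x"
    by (simp add: dn)
  also have "\<dots> = 0"
    using dir_deriv_commutator[OF P(1) Q(1) n] * P Q by simp
  finally show ?thesis by simp
qed

lemma lie_bracket_ex1: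
  assumes "U \<in> alg_vector_fields" "V \<in> alg_vector_fields"
  shows "\<exists>!W. W \<in> alg_vector_fields \<and>
    (\<forall>f\<in>alg_functions. \<forall>x\<in>S2.
       vf_action W f x = vf_action U (vf_action V f) x - vf_action V (vf_action U f) x)"
proof (rule ex_ex1I)
  obtain P Q where U: "U = restrict P S2" and P: "polynomial_function P" "\<And>x. x \<in> S2 \<Longrightarrow> x \<bullet> P x = 0"
    and V: "V = restrict Q S2" and Q: "polynomial_function Q" "\<And>x. x \<in> S2 \<Longrightarrow> x \<bullet> Q x = 0"
    using assms unfolding alg_vector_fields_def by blast
  note C = polynomial_function_commutator[OF P(1) Q(1)] commutator_tangent[OF P Q]
  have "restrict (commutator P Q) S2 \<in> alg_vector_fields"
    using C unfolding alg_vector_fields_def by blast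
  moreover have "vf_action (restrict (commutator P Q) S2) f x
      = vf_action U (vf_action V f) x - vf_action V (vf_action U f) x"
    if "f \<in> alg_functions" "x \<in> S2" for f x
  proof -
    obtain p where f: "f = restrict p S2" and p: "real_polynomial_function p"
      using \<open>f \<in> alg_functions\<close> unfolding alg_functions_def by blast
    have act: "vf_action (restrict R S2) (restrict q S2) = restrict (dir_deriv R q) S2"
      if "\<And>x. x \<in> S2 \<Longrightarrow> x \<bullet> R x = 0" "real_polynomial_function q" for R q
      using that by (intro vf_action_restrict)
    have x: "restrict g S2 x = g x" for g :: "real^3 \<Rightarrow> real"
      using \<open>x \<in> S2\<close> by (rule restrict_apply')
    have "vf_action (restrict (commutator P Q) S2) f x = dir_deriv (commutator P Q) p x"
      unfolding f by (subst act) (use C p x in auto)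
    moreover have "vf_action U (vf_action V f) x = dir_deriv P (dir_deriv Q p) x"
      unfolding f U V
      by (subst act, use Q p in blast, use p in blast, subst act)
        (use P Q p x in \<open>auto intro: real_polynomial_function_dir_deriv\<close>)
    moreover have "vf_action V (vf_action U f) x = dir_deriv Q (dir_deriv P p) x"
      unfolding f U V
      by (subst act, use P p in blast, use p in blast, subst act)
        (use P Q p x in \<open>auto intro: real_polynomial_function_dir_deriv\<close>)
    ultimately show ?thesis
      using dir_deriv_commutator[OF P(1) Q(1) p] by simp
  qed
  ultimately show "\<exists>W. W \<in> alg_vector_fields \<and> (\<forall>f\<in>alg_functions. \<forall>x\<in>S2.
       vf_action W f x = vf_action U (vf_action V f) x - vf_action V (vf_action U f) x)"
    by blast
next
  fix W W'
  assume W: "W \<in> alg_vector_fields \<and> (\<forall>f\<in>alg_functions. \<forall>x\<in>S2.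
       vf_action W f x = vf_action U (vf_action V f) x - vf_action V (vf_action U f) x)"
    and W': "W' \<in> alg_vector_fields \<and> (\<forall>f\<in>alg_functions. \<forall>x\<in>S2.
       vf_action W' f x = vf_action U (vf_action V f) x - vf_action V (vf_action U f) x)"
  have coord: "real_polynomial_function (\<lambda>x::real^3. x $ i)" for i
    by (intro real_polynomial_function.intros(1) bounded_linear_vec_nth)
  have nth: "vf_action T (restrict (\<lambda>x. x $ i) S2) x = T x $ i"
    if "T \<in> alg_vector_fields" "x \<in> S2" for T x i
  proof -
    obtain P where "T = restrict P S2" "\<forall>x\<in>S2. x \<bullet> P x = 0"
      using \<open>T \<in> alg_vector_fields\<close> unfolding alg_vector_fields_def by blast
    then have "vf_action T (restrict (\<lambda>x. x $ i) S2) = restrict (dir_deriv P (\<lambda>x. x $ i)) S2"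
      by (simp only:) (rule vf_action_restrict[OF coord], simp)
    then show ?thesis
      using \<open>x \<in> S2\<close> \<open>T = restrict P S2\<close>
      by (simp add: dir_deriv_simps(1) bounded_linear_vec_nth)
  qed
  have "W x = W' x" if "x \<in> S2" for x
  proof -
    have "restrict (\<lambda>x. x $ i) S2 \<in> alg_functions" for i
      using coord unfolding alg_functions_def by blast
    then have "W x $ i = W' x $ i" for i
      using W W' nth that by metis
    then show ?thesis by (simp add: vec_eq_iff)
  qed
  moreover have "W \<in> extensional S2" "W' \<in> extensional S2"
    using W W' by (auto simp: alg_vector_fields_def)
  ultimately show "W = W'" by (auto intro: extensionalityI)
qed

lemma lie_bracket_works:
  assumes "U \<in> alg_vector_fields" "V \<in> alg_vector_fields"
  shows "lie_bracket U V \<in> alg_vector_fields"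
    and "f \<in> alg_functions \<Longrightarrow> x \<in> S2 \<Longrightarrow> vf_action (lie_bracket U V) f x
      = vf_action U (vf_action V f) x - vf_action V (vf_action U f) x"
  using theI'[OF lie_bracket_ex1[OF assms]] unfolding lie_bracket_def by blast+

lemma lie_subalgebra_alg_vector_fields: "lie_subalgebra alg_vector_fields"
proof -
  have "vf_zero \<in> alg_vector_fields"
    unfolding vf_zero_def alg_vector_fields_def by auto
  moreover have "vf_add U V \<in> alg_vector_fields"
    if UV: "U \<in> alg_vector_fields" "V \<in> alg_vector_fields" for U V
  proof -
    obtain P where P: "U = restrict P S2" "polynomial_function P" "\<forall>x\<in>S2. x \<bullet> P x = 0"
      using UV(1) unfolding alg_vector_fields_def by blast
    obtain Q where Q: "V = restrict Q S2" "polynomial_function Q" "\<forall>x\<in>S2. x \<bullet> Q x = 0"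
      using UV(2) unfolding alg_vector_fields_def by blast
    have "vf_add U V = restrict (\<lambda>x. P x + Q x) S2"
      unfolding vf_add_def P(1) Q(1) by (rule restrict_ext) simp
    moreover have "polynomial_function (\<lambda>x. P x + Q x)"
      using P(2) Q(2) by (rule polynomial_function_add)
    moreover have "\<forall>x\<in>S2. x \<bullet> (P x + Q x) = 0"
      using P(3) Q(3) by (simp add: inner_add_right)
    ultimately show ?thesis
      unfolding alg_vector_fields_def by blast
  qed
  moreover have "vf_scale c U \<in> alg_vector_fields" if U: "U \<in> alg_vector_fields" for c U
  proof -
    obtain P where P: "U = restrict P S2" "polynomial_function P" "\<forall>x\<in>S2. x \<bullet> P x = 0"
      using U unfolding alg_vector_fields_def by blast
    have "vf_scale c U = restrict (\<lambda>x. c *\<^sub>R P x) S2"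
      unfolding vf_scale_def P(1) by (rule restrict_ext) simp
    moreover have "polynomial_function (\<lambda>x. c *\<^sub>R P x)"
      by (rule polynomial_function_mult[OF polynomial_function_const P(2)])
    moreover have "\<forall>x\<in>S2. x \<bullet> (c *\<^sub>R P x) = 0"
      using P(3) by simp
    ultimately show ?thesis
      unfolding alg_vector_fields_def by blast
  qed
  ultimately show ?thesis
    unfolding lie_subalgebra_def using lie_bracket_works(1) by blast
qed

lemma lie_subalgebra_lie_generated:
  assumes "A \<subseteq> alg_vector_fields"
  shows "lie_subalgebra (lie_generated A)"
proof -
  have "lie_generated A \<subseteq> alg_vector_fields"
    unfolding lie_generated_def
    using hull_minimal[of A alg_vector_fields lie_subalgebra] assms
      lie_subalgebra_alg_vector_fields by blast
  then show ?thesis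
    unfolding lie_subalgebra_def lie_generated_def hull_def by blast
qed

lemma gradient_eqI: "GDERIV f x :> D \<Longrightarrow> gradient f x = D"
  unfolding gradient_def
proof (rule the_equality)
  fix D' assume "GDERIV f x :> D" "GDERIV f x :> D'"
  then have "(\<lambda>h. h \<bullet> D') = (\<lambda>h. h \<bullet> D)"
    unfolding gderiv_def using has_derivative_unique by blast
  then show "D' = D" by (metis vector_eq_rdot inner_commute)
qed

end

theory Submission
  imports Defs
begin

text \<open>
  Write \<open>R_i\<close> for \<open>X_f\<close> with \<open>f = x_i\<close>, \<open>{f,g} = X_f g\<close> and \<open>G_3\<close> for \<open>G_f\<close> with \<open>f = x_3\<close>.
  Then \<open>[X_f, X_g] = X_{f,g}\<close> and \<open>[G_3, X_f] = X_h + 2 x_3 X_f\<close> with \<open>h = G_3 f\<close>.  Applying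
  \<open>ad W_1 + (ad W_1)^3\<close> to \<open>W_2\<close> leaves a multiple of \<open>X_f\<close> with \<open>f = x_1 x_2\<close>; from it and
  further brackets one gets \<open>G_3\<close> and \<open>X_f\<close> for every \<open>f\<close> of degree at most 2.

  The set of all \<open>f\<close> with \<open>X_f\<close> in the generated algebra is closed under
  \<open>f \<mapsto> \<Sum>_j {x_j, {x_i x_j, f}} = x_i \<Delta> f + G_i f\<close>, where \<open>\<Delta>\<close> is the spherical Laplacian.  On
  polynomials of degree \<open>n\<close> this is \<open>- n (n + 2) x_i f\<close> up to degree \<open>n\<close>, so induction on the
  degree gives \<open>X_f\<close> for all polynomials \<open>f\<close>.

  Now the second bracket identity yields \<open>x_3 X_f\<close>, hence \<open>f R_3 = X_{x_3 f} - x_3 X_f\<close>, and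
  brackets with the rotations give \<open>f R_i\<close> for all \<open>i\<close>.  Every tangent field is a combination of
  these, since \<open>P = x \<times> (P \<times> x)\<close> on the sphere.
\<close>

subsection \<open>Brackets of Hamiltonian fields\<close>

definition partial :: "3 \<Rightarrow> (real^3 \<Rightarrow> real) \<Rightarrow> real^3 \<Rightarrow> real"
  where "partial k f x = frechet_derivative f (at x) (axis k 1)"

definition grad :: "(real^3 \<Rightarrow> real) \<Rightarrow> real^3 \<Rightarrow> real^3"
  where "grad f x = (\<chi> k. partial k f x)"

text \<open>Polynomial on all of \<open>real^3\<close>, so brackets become computations with
  ordinary partial derivatives; for polynomial \<open>f\<close> its restriction to \<open>S2\<close>
  is \<open>X_field f\<close>.\<close>

definition ham :: "(real^3 \<Rightarrow> real) \<Rightarrow> real^3 \<Rightarrow> real^3"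
  where "ham f x = cross3 x (grad f x)"

lemma partial_eq_dir_deriv: "partial k f = dir_deriv (\<lambda>x. axis k 1) f"
  by (simp add: fun_eq_iff partial_def dir_deriv_def)

lemma dir_deriv_partial:
  assumes "real_polynomial_function f"
  shows "dir_deriv P f x = (\<Sum>k\<in>UNIV. P x $ k * partial k f x)"
proof -
  have "bounded_linear (frechet_derivative f (at x))"
    using real_polynomial_function_has_derivative[OF assms] has_derivative_bounded_linear by blast
  from linear_functional_sum[OF this, of "P x"] show ?thesis
    by (simp add: dir_deriv_def partial_def mult.commute)
qed

lemma real_polynomial_function_const [simp]: "real_polynomial_function (\<lambda>x. c)"
  by (rule real_polynomial_function.intros)

lemma real_polynomial_function_coord [simp]: "real_polynomial_function (\<lambda>x::real^3. x $ k)"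
  by (simp add: bounded_linear_vec_nth real_polynomial_function.intros(1))

lemma real_polynomial_function_simps [simp]:
  assumes "real_polynomial_function f" "real_polynomial_function g"
  shows "real_polynomial_function (\<lambda>x. f x + g x)"
    and "real_polynomial_function (\<lambda>x. f x - g x)"
    and "real_polynomial_function (\<lambda>x. f x * g x)"
  using assms by auto

lemma real_polynomial_function_unary [simp]:
  assumes "real_polynomial_function f"
  shows "real_polynomial_function (\<lambda>x. - f x)"
    and "real_polynomial_function (\<lambda>x. (f x)\<^sup>2)"
  using assms by (auto simp: real_polynomial_function_minus real_polynomial_function_power)

lemma real_polynomial_function_partial [simp]:
  "real_polynomial_function f \<Longrightarrow> real_polynomial_function (partial k f)"
  by (simp add: partial_eq_dir_deriv real_polynomial_function_dir_deriv)

lemma partial_const [simp]: "partial k (\<lambda>x. c) = (\<lambda>x. 0)"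
  by (simp add: partial_eq_dir_deriv dir_deriv_simps)

lemma partial_linear: "bounded_linear f \<Longrightarrow> partial k f = (\<lambda>x. f (axis k 1))"
  by (simp add: partial_eq_dir_deriv dir_deriv_simps)

lemma partial_coord [simp]: "partial k (\<lambda>x. x $ j) = (\<lambda>x. if j = k then 1 else 0)"
  by (auto simp: partial_linear bounded_linear_vec_nth axis_def)

lemma partial_add [simp]:
  assumes "real_polynomial_function f" "real_polynomial_function g"
  shows "partial k (\<lambda>x. f x + g x) = (\<lambda>x. partial k f x + partial k g x)"
  using assms by (simp add: partial_eq_dir_deriv dir_deriv_simps)

lemma partial_mult [simp]:
  assumes "real_polynomial_function f" "real_polynomial_function g"
  shows "partial k (\<lambda>x. f x * g x) = (\<lambda>x. f x * partial k g x + partial k f x * g x)"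
  using assms by (simp add: partial_eq_dir_deriv dir_deriv_simps)

lemma partial_minus [simp]:
  assumes "real_polynomial_function f"
  shows "partial k (\<lambda>x. - f x) = (\<lambda>x. - partial k f x)"
  using partial_mult[of "\<lambda>x. -1" f k] assms by (simp add: real_polynomial_function.intros)

lemma partial_diff [simp]:
  assumes "real_polynomial_function f" "real_polynomial_function g"
  shows "partial k (\<lambda>x. f x - g x) = (\<lambda>x. partial k f x - partial k g x)"
  using partial_add[of f "\<lambda>x. - g x" k] assms by (simp add: real_polynomial_function_minus)

lemma partial_power2 [simp]:
  assumes "real_polynomial_function f"
  shows "partial k (\<lambda>x. (f x)\<^sup>2) = (\<lambda>x. 2 * f x * partial k f x)"
  using assms by (simp add: power2_eq_square algebra_simps)

lemma partial_commute:
  assumes "real_polynomial_function f"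
  shows "partial i (partial j f) = partial j (partial i f)"
  using assms
proof (induction f rule: real_polynomial_function.induct)
  case (linear f)
  then show ?case by (simp add: partial_linear)
next
  case (mult f g)
  show ?case using mult by (simp, simp add: algebra_simps)
qed simp_all

lemma ham_nth:
  "ham f x $ 1 = x $ 2 * partial 3 f x - x $ 3 * partial 2 f x"
  "ham f x $ 2 = x $ 3 * partial 1 f x - x $ 1 * partial 3 f x"
  "ham f x $ 3 = x $ 1 * partial 2 f x - x $ 2 * partial 1 f x"
  by (simp_all add: ham_def grad_def cross3_def)

lemma polynomial_function_ham:
  assumes "real_polynomial_function f"
  shows "polynomial_function (ham f)"
proof (rule polynomial_functionI_nth)
  have "\<forall>i. real_polynomial_function (\<lambda>y. ham f y $ i)"
    using assms by (simp add: forall_3 ham_nth)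
  then show "real_polynomial_function (\<lambda>y. ham f y $ i)" for i ..
qed

lemma ham_tangent: "x \<bullet> ham f x = 0"
  by (simp add: ham_def dot_cross_self)

text \<open>For polynomial \<open>g\<close> the value at x is det(x, grad f, grad g), the
  Lie-Poisson bracket of so(3) up to a sign convention.\<close>

definition poisson :: "(real^3 \<Rightarrow> real) \<Rightarrow> (real^3 \<Rightarrow> real) \<Rightarrow> real^3 \<Rightarrow> real"
  where "poisson f = dir_deriv (ham f)"

lemma poisson_expand:
  assumes "real_polynomial_function g"
  shows "poisson f g = (\<lambda>x. (x $ 2 * partial 3 f x - x $ 3 * partial 2 f x) * partial 1 g x
    + (x $ 3 * partial 1 f x - x $ 1 * partial 3 f x) * partial 2 g x
    + (x $ 1 * partial 2 f x - x $ 2 * partial 1 f x) * partial 3 g x)"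
  using assms by (simp add: fun_eq_iff poisson_def dir_deriv_partial sum_3 ham_nth)

text \<open>This is the Jacobi identity of the Lie-Poisson bracket in terms of fields, so it holds
  on all of space and not only on the sphere. After expansion only the symmetry of mixed partials is
  used.\<close>

lemma commutator_ham:
  assumes [simp]: "real_polynomial_function f" "real_polynomial_function g"
  shows "commutator (ham f) (ham g) = ham (poisson f g)"
proof
  fix x
  \<comment> \<open>These instances are oriented: they move the smaller index outward and so
    normalize mixed partials.\<close>
  note c = partial_commute[of _ 2 1] partial_commute[of _ 3 1] partial_commute[of _ 3 2]
  show "commutator (ham f) (ham g) x = ham (poisson f g) x"
    by (simp add: vec_eq_iff forall_3 commutator_def dir_deriv_partial sum_3 ham_nth poisson_expand c)
      (simp add: algebra_simps)
qed

definition G3 :: "real^3 \<Rightarrow> real^3"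
  where "G3 x = axis 3 1 - x $ 3 *\<^sub>R x"

lemma G3_nth: "G3 x $ 1 = - x $ 3 * x $ 1" "G3 x $ 2 = - x $ 3 * x $ 2" "G3 x $ 3 = 1 - x $ 3 * x $ 3"
  by (simp_all add: G3_def axis_def)

lemma norm_S2: "x \<in> S2 \<Longrightarrow> x $ 1 * x $ 1 + x $ 2 * x $ 2 + x $ 3 * x $ 3 = (1::real)"
  by (simp add: norm_eq_1 inner_vec_def sum_3)

text \<open>\<open>G3\<close> does not preserve area: its divergence on the sphere is -2 x_3, and
  this produces the second term. That term leads out of the divergence-free fields
  \<open>ham f\<close>.\<close>

lemma commutator_G3_ham:
  assumes [simp]: "real_polynomial_function f" and x: "x \<in> S2"
  shows "commutator G3 (ham f) x = ham (dir_deriv G3 f) x + (2 * x $ 3) *\<^sub>R ham f x"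
proof -
  note c = partial_commute[OF assms(1), of 2 1] partial_commute[OF assms(1), of 3 1]
    partial_commute[OF assms(1), of 3 2]
  have d: "dir_deriv G3 f = (\<lambda>x. - x $ 3 * x $ 1 * partial 1 f x + - x $ 3 * x $ 2 * partial 2 f x
    + (1 - x $ 3 * x $ 3) * partial 3 f x)"
    by (simp add: fun_eq_iff dir_deriv_partial sum_3 G3_nth)
  have s: "1 = x $ 1 * x $ 1 + x $ 2 * x $ 2 + x $ 3 * x $ 3" using norm_S2[OF x] by simp
  \<comment> \<open>Off the sphere the identity has an error term with the factor 1 - x . x.\<close>
  have "commutator G3 (ham f) x = ham (dir_deriv G3 f) x + (2 * x $ 3) *\<^sub>R ham f x
      + (1 - x \<bullet> x) *\<^sub>R cross3 (axis 3 1) (grad f x)"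
    by (simp add: vec_eq_iff forall_3 commutator_def dir_deriv_partial sum_3 ham_nth G3_nth d c
        inner_vec_def cross3_def grad_def axis_def)
      (simp add: c algebra_simps)
  then show ?thesis using s by (simp add: inner_vec_def sum_3)
qed

section \<open>Brackets and derivatives on the sphere through polynomial representatives\<close>

lemma vf_action_coord:
  assumes "T \<in> alg_vector_fields" "x \<in> S2"
  shows "vf_action T (restrict (\<lambda>x. x $ i) S2) x = T x $ i"
proof -
  obtain P where P: "T = restrict P S2" "\<And>x. x\<in>S2 \<Longrightarrow> x \<bullet> P x = 0"
    using assms unfolding alg_vector_fields_def by blast
  have "vf_action T (restrict (\<lambda>x. x $ i) S2) = restrict (dir_deriv P (\<lambda>x. x $ i)) S2"
    unfolding P(1) by (intro vf_action_restrict P(2)) auto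
  then show ?thesis
    using assms(2) by (simp add: P(1) dir_deriv_simps(1) bounded_linear_vec_nth)
qed

lemma restrict_in_alg_vector_fields:
  assumes "restrict P S2 \<in> alg_vector_fields" "x \<in> S2"
  shows "x \<bullet> P x = 0"
proof -
  obtain Q where "restrict P S2 = restrict Q S2" "\<forall>x\<in>S2. x \<bullet> Q x = 0"
    using assms(1) unfolding alg_vector_fields_def by blast
  moreover from this have "P x = Q x"
    using assms(2) by (metis restrict_apply')
  ultimately show ?thesis using assms(2) by simp
qed

text \<open>\<open>lie_bracket\<close> is known only through its action on functions. Acting on the
  coordinate functions recovers its components, which are then those of
  \<open>commutator P Q\<close>.\<close>

lemma lie_bracket_restrict:
  assumes P: "polynomial_function P" "restrict P S2 \<in> alg_vector_fields"
    and Q: "polynomial_function Q" "restrict Q S2 \<in> alg_vector_fields"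
  shows "lie_bracket (restrict P S2) (restrict Q S2) = restrict (commutator P Q) S2"
proof (rule extensionalityI)
  note b = lie_bracket_works[OF P(2) Q(2)]
  show "lie_bracket (restrict P S2) (restrict Q S2) \<in> extensional S2"
    using b(1) by (auto simp: alg_vector_fields_def)
  fix x :: "real^3" assume x: "x \<in> S2"
  have act: "vf_action (restrict S S2) (vf_action (restrict T S2) (restrict (\<lambda>x. x $ i) S2)) x
      = dir_deriv S (\<lambda>y. T y $ i) x"
    if "polynomial_function S" "restrict S S2 \<in> alg_vector_fields"
      "polynomial_function T" "restrict T S2 \<in> alg_vector_fields" for S T i
  proof -
    have "vf_action (restrict T S2) (restrict (\<lambda>x. x $ i) S2) = restrict (\<lambda>y. T y $ i) S2"
      by (rule extensionalityI[of _ S2]) (use vf_action_coord[OF that(4)] in \<open>simp_all add: vf_action_def\<close>)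
    then show ?thesis
      using vf_action_restrict[of "\<lambda>y. T y $ i" S] x that
      by (simp add: restrict_in_alg_vector_fields real_polynomial_function_nth)
  qed
  have "lie_bracket (restrict P S2) (restrict Q S2) x $ i = commutator P Q x $ i" for i
  proof -
    have "restrict (\<lambda>x. x $ i) S2 \<in> alg_functions"
      unfolding alg_functions_def using real_polynomial_function_coord by blast
    from b(2)[OF this x] show ?thesis
      using P Q by (simp add: vf_action_coord[OF b(1) x] act commutator_def)
  qed
  then show "lie_bracket (restrict P S2) (restrict Q S2) x = restrict (commutator P Q) S2 x"
    using x by (simp add: vec_eq_iff)
qed simp

text \<open>A derivative in a tangent direction sees only values on the sphere. All later changes of
  representative modulo x . x = 1 rest on this.\<close>

lemma dir_deriv_cong_S2:
  assumes "real_polynomial_function f" "real_polynomial_function g" "\<And>x. x \<in> S2 \<Longrightarrow> f x = g x"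
    and "x \<in> S2" "x \<bullet> P x = 0"
  shows "dir_deriv P f x = dir_deriv P g x"
  using frechet_derivative_within_S2[OF assms(4,5) real_polynomial_function_has_derivative[OF assms(1)], of f]
    frechet_derivative_within_S2[OF assms(4,5) real_polynomial_function_has_derivative[OF assms(2)], of f]
    assms(3) by (simp add: dir_deriv_def)

text \<open>The derivation along x \<times> e_j, an infinitesimal rotation about the
  \<open>j\<close>-th axis.\<close>

definition rot :: "3 \<Rightarrow> (real^3 \<Rightarrow> real) \<Rightarrow> real^3 \<Rightarrow> real"
  where "rot j = poisson (\<lambda>x. x $ j)"

lemma rot_expand:
  assumes "real_polynomial_function f"
  shows "rot 1 f = (\<lambda>x. x $ 3 * partial 2 f x - x $ 2 * partial 3 f x)"
    "rot 2 f = (\<lambda>x. x $ 1 * partial 3 f x - x $ 3 * partial 1 f x)"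
    "rot 3 f = (\<lambda>x. x $ 2 * partial 1 f x - x $ 1 * partial 2 f x)"
  using assms by (simp_all add: rot_def poisson_expand)

lemma poisson_cong_S2:
  assumes "real_polynomial_function f" "real_polynomial_function g" "\<And>x. x \<in> S2 \<Longrightarrow> f x = g x"
    and "x \<in> S2"
  shows "poisson h f x = poisson h g x"
  unfolding poisson_def using assms by (intro dir_deriv_cong_S2) (auto simp: ham_tangent)

lemma real_polynomial_function_poisson [simp]:
  assumes "real_polynomial_function f" "real_polynomial_function g"
  shows "real_polynomial_function (poisson f g)"
  using assms by (simp add: poisson_def real_polynomial_function_dir_deriv polynomial_function_ham)

lemma real_polynomial_function_rot [simp]:
  "real_polynomial_function g \<Longrightarrow> real_polynomial_function (rot j g)"
  by (simp add: rot_def)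

text \<open>Triple product: e_j . (x \<times> grad f) = - (x \<times> e_j) . grad f. So the
  components of \<open>ham f\<close> are tangential derivatives of \<open>f\<close>, which gives
  \<open>ham_cong_S2\<close>.\<close>

lemma ham_nth_rot:
  assumes "real_polynomial_function f"
  shows "ham f x $ j = - rot j f x"
  using assms exhaust_3[of j] by (auto simp: ham_nth rot_expand)

lemma ham_cong_S2:
  assumes "real_polynomial_function f" "real_polynomial_function g" "\<And>x. x \<in> S2 \<Longrightarrow> f x = g x"
    and "x \<in> S2"
  shows "ham f x = ham g x"
  using poisson_cong_S2[OF assms] assms(1,2) by (simp add: vec_eq_iff ham_nth_rot rot_def)

lemma ham_mult:
  assumes "real_polynomial_function f" "real_polynomial_function g"
  shows "ham (\<lambda>x. f x * g x) x = f x *\<^sub>R ham g x + g x *\<^sub>R ham f x"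
  using assms by (simp add: vec_eq_iff forall_3 ham_nth algebra_simps)

lemma ham_add:
  assumes "real_polynomial_function f" "real_polynomial_function g"
  shows "ham (\<lambda>x. f x + g x) x = ham f x + ham g x"
  using assms by (simp add: vec_eq_iff forall_3 ham_nth algebra_simps)

lemma ham_const: "ham (\<lambda>x. c) = (\<lambda>x. 0)"
  by (simp add: fun_eq_iff vec_eq_iff forall_3 ham_nth)

subsection \<open>The degree filtration on the sphere\<close>

text \<open>The restriction of \<open>f\<close> to the sphere has degree at most \<open>n\<close>;
  the rule \<open>cong\<close> works modulo x . x = 1. The inductive form lets degree estimates go
  by rule induction, without a decomposition into spherical harmonics.\<close>

inductive sphere_degree :: "nat \<Rightarrow> (real^3 \<Rightarrow> real) \<Rightarrow> bool" where
  const: "sphere_degree n (\<lambda>x. c)"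
| add: "sphere_degree n f \<Longrightarrow> sphere_degree n g \<Longrightarrow> sphere_degree n (\<lambda>x. f x + g x)"
| coord: "sphere_degree n f \<Longrightarrow> sphere_degree (Suc n) (\<lambda>x. x $ k * f x)"
| cong: "sphere_degree n f \<Longrightarrow> real_polynomial_function g \<Longrightarrow> (\<And>x. x \<in> S2 \<Longrightarrow> g x = f x)
    \<Longrightarrow> sphere_degree n g"

lemma sphere_degree_polynomial: "sphere_degree n f \<Longrightarrow> real_polynomial_function f"
  by (induction rule: sphere_degree.induct) auto

lemma sphere_degree_Suc: "sphere_degree n f \<Longrightarrow> sphere_degree (Suc n) f"
proof (induction rule: sphere_degree.induct)
  case (cong n f g)
  from cong.IH cong.hyps(2,3) show ?case by (rule sphere_degree.cong)
qed (rule sphere_degree.const sphere_degree.add sphere_degree.coord; assumption)+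

lemma sphere_degree_mono: "m \<le> n \<Longrightarrow> sphere_degree m f \<Longrightarrow> sphere_degree n f"
  by (induction n rule: dec_induct) (auto intro: sphere_degree_Suc)

lemma sphere_degree_cmult: "sphere_degree n f \<Longrightarrow> sphere_degree n (\<lambda>x. c * f x)"
proof (induction rule: sphere_degree.induct)
  case (coord n f k)
  then show ?case using sphere_degree.coord[of n "\<lambda>x. c * f x" k] by (simp add: algebra_simps)
next
  case (add n f g)
  show ?case using sphere_degree.add[OF add.IH] by (simp add: distrib_left)
next
  case (cong n f g)
  show ?case
    by (rule sphere_degree.cong[OF cong.IH]) (use cong.hyps in simp_all)
qed (simp add: sphere_degree.const)

lemma sphere_degree_mult:
  assumes "sphere_degree m f" "sphere_degree n g"
  shows "sphere_degree (m + n) (\<lambda>x. f x * g x)"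
  using assms(1)
proof (induction rule: sphere_degree.induct)
  case (const m c)
  show ?case
    by (rule sphere_degree_mono[of n]) (simp_all add: assms(2) sphere_degree_cmult)
next
  case (add m f h)
  show ?case using sphere_degree.add[OF add.IH] by (simp add: distrib_right)
next
  case (coord m f k)
  then show ?case using sphere_degree.coord[OF coord.IH, of k] by (simp add: mult.assoc)
next
  case (cong m f h)
  show ?case
    by (rule sphere_degree.cong[OF cong.IH])
      (use cong.hyps sphere_degree_polynomial[OF assms(2)] in simp_all)
qed

lemma sphere_degree_coord: "sphere_degree (Suc n) (\<lambda>x. x $ k)"
  using sphere_degree.coord[OF sphere_degree.const[of _ 1]] by simp

lemma sphere_degree_exists:
  assumes "real_polynomial_function f"
  shows "\<exists>n. sphere_degree n f"
  using assms
proof (induction f rule: real_polynomial_function.induct)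
  case (linear f)
  have k: "sphere_degree 1 (\<lambda>x. f (axis k 1) * x $ k)" for k
    using sphere_degree_cmult[OF sphere_degree_coord[of 0]] by simp
  have "sphere_degree 1 (\<lambda>x. \<Sum>k\<in>UNIV. f (axis k 1) * x $ k)"
    unfolding sum_3 by (intro sphere_degree.add[OF sphere_degree.add[OF k k] k])
  moreover have "f = (\<lambda>x. \<Sum>k\<in>UNIV. f (axis k 1) * x $ k)"
    using linear_functional_sum[OF linear] by (rule ext)
  ultimately show ?case by (intro exI[of _ 1]) simp
next
  case (add f g)
  then obtain m n where "sphere_degree m f" "sphere_degree n g" by blast
  then have "sphere_degree (max m n) f" "sphere_degree (max m n) g"
    using sphere_degree_mono[of m "max m n" f] sphere_degree_mono[of n "max m n" g] by simp_all
  from sphere_degree.add[OF this] show ?case by (rule exI)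
next
  case (const c)
  show ?case by (intro exI[of _ 0] sphere_degree.const)
next
  case (mult f g)
  then obtain m n where "sphere_degree m f" "sphere_degree n g" by blast
  from sphere_degree_mult[OF this] show ?case by (rule exI)
qed

lemma sphere_degree_0:
  assumes "sphere_degree n f" "n = 0"
  shows "\<exists>c. \<forall>x\<in>S2. f x = c"
  using assms by (induction rule: sphere_degree.induct) auto

section \<open>The spherical Laplacian and gradients on the degree filtration\<close>

definition sphere_laplacian :: "(real^3 \<Rightarrow> real) \<Rightarrow> real^3 \<Rightarrow> real"
  where "sphere_laplacian f x = (\<Sum>j\<in>UNIV. rot j (rot j f) x)"

text \<open>The polarization of the Casimir sum \<open>sphere_laplacian\<close>. On the sphere it is
  the inner product of the tangential gradients of x_i and \<open>f\<close>, that is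
  \<open>G_i f\<close>, because (x \<times> a) . (x \<times> b) = a . b - (x . a) (x . b)
  there.\<close>

definition sphere_grad :: "3 \<Rightarrow> (real^3 \<Rightarrow> real) \<Rightarrow> real^3 \<Rightarrow> real"
  where "sphere_grad i f x = (\<Sum>j\<in>UNIV. rot j (\<lambda>x. x $ i) x * rot j f x)"

lemma poisson_simps [simp]:
  "poisson h (\<lambda>x. c) = (\<lambda>x. 0)"
  "real_polynomial_function f \<Longrightarrow> real_polynomial_function g \<Longrightarrow>
    poisson h (\<lambda>x. f x + g x) = (\<lambda>x. poisson h f x + poisson h g x)"
  "real_polynomial_function f \<Longrightarrow> real_polynomial_function g \<Longrightarrow>
    poisson h (\<lambda>x. f x * g x) = (\<lambda>x. f x * poisson h g x + poisson h f x * g x)"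
  by (simp_all add: poisson_def dir_deriv_simps)

lemma rot_simps [simp]:
  "rot j (\<lambda>x. c) = (\<lambda>x. 0)"
  "real_polynomial_function f \<Longrightarrow> real_polynomial_function g \<Longrightarrow>
    rot j (\<lambda>x. f x + g x) = (\<lambda>x. rot j f x + rot j g x)"
  "real_polynomial_function f \<Longrightarrow> real_polynomial_function g \<Longrightarrow>
    rot j (\<lambda>x. f x * g x) = (\<lambda>x. f x * rot j g x + rot j f x * g x)"
  by (simp_all add: rot_def)

lemma sphere_grad_coord:
  "x \<in> S2 \<Longrightarrow> sphere_grad i (\<lambda>x. x $ k) x = (if i = k then 1 else 0) - x $ i * x $ k"
  using exhaust_3[of i] exhaust_3[of k] norm_S2[of x]
  by (auto simp: sphere_grad_def sum_3 rot_expand algebra_simps)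

lemma sphere_laplacian_coord: "sphere_laplacian (\<lambda>x. x $ k) x = - 2 * x $ k"
  using exhaust_3[of k] by (auto simp: sphere_laplacian_def sum_3 rot_expand)

text \<open>Leibniz rule of a second-order operator: the cross term is twice
  \<open>sphere_grad\<close>, and x_k is an eigenfunction for -2.\<close>

lemma sphere_laplacian_mult:
  assumes [simp]: "real_polynomial_function f"
  shows "sphere_laplacian (\<lambda>x. x $ k * f x) x = - 2 * x $ k * f x + 2 * sphere_grad k f x + x $ k * sphere_laplacian f x"
proof -
  have "sphere_laplacian (\<lambda>x. x $ k * f x) x
      = f x * sphere_laplacian (\<lambda>x. x $ k) x + 2 * sphere_grad k f x + x $ k * sphere_laplacian f x"
    by (simp add: sphere_laplacian_def sphere_grad_def sum_3 algebra_simps)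
  then show ?thesis by (simp add: sphere_laplacian_coord)
qed

lemma real_polynomial_function_sphere_grad [simp]:
  "real_polynomial_function f \<Longrightarrow> real_polynomial_function (sphere_grad i f)"
  unfolding sphere_grad_def sum_3 by simp

lemma real_polynomial_function_sphere_laplacian [simp]:
  "real_polynomial_function f \<Longrightarrow> real_polynomial_function (sphere_laplacian f)"
  unfolding sphere_laplacian_def sum_3 by simp

lemma rot_cong_S2:
  assumes "real_polynomial_function f" "real_polynomial_function g" "\<And>x. x \<in> S2 \<Longrightarrow> f x = g x"
    and "x \<in> S2"
  shows "rot j f x = rot j g x"
  unfolding rot_def using assms by (rule poisson_cong_S2)

lemma sphere_grad_cong_S2:
  assumes "real_polynomial_function f" "real_polynomial_function g" "\<And>x. x \<in> S2 \<Longrightarrow> f x = g x"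
    and "x \<in> S2"
  shows "sphere_grad i f x = sphere_grad i g x"
  using rot_cong_S2[OF assms] by (simp add: sphere_grad_def)

lemma sphere_laplacian_cong_S2:
  assumes "real_polynomial_function f" "real_polynomial_function g" "\<And>x. x \<in> S2 \<Longrightarrow> f x = g x"
    and "x \<in> S2"
  shows "sphere_laplacian f x = sphere_laplacian g x"
  using rot_cong_S2[of "rot j f" "rot j g" x j for j] rot_cong_S2[OF assms(1-3)] assms
  by (simp add: sphere_laplacian_def)

text \<open>On the sphere \<open>G_i f\<close> is d_i f - x_i (x . grad f), and by Euler's identity
  x . grad f is n f up to lower degree; the added term cancels this top part. In the induction every
  new factor x_k contributes one - x_i x_k f.\<close>

lemma sphere_degree_sphere_grad:
  "sphere_degree n f \<Longrightarrow> sphere_degree n (\<lambda>x. sphere_grad i f x + real n * (x $ i * f x))"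
proof (induction rule: sphere_degree.induct)
  case (const n c)
  show ?case
  proof (cases n)
    case (Suc m)
    then show ?thesis
      using sphere_degree_cmult[OF sphere_degree_coord[of m i], of "real n * c"]
      by (simp add: sphere_grad_def mult_ac)
  qed (simp add: sphere_grad_def sphere_degree.const)
next
  case (add n f g)
  have "sphere_degree n (\<lambda>x. (sphere_grad i f x + real n * (x $ i * f x)) + (sphere_grad i g x + real n * (x $ i * g x)))"
    by (rule sphere_degree.add) (rule add.IH)+
  moreover have "real_polynomial_function f" "real_polynomial_function g"
    using add by (auto intro: sphere_degree_polynomial)
  ultimately show ?case
    by (simp add: sphere_grad_def distrib_left sum.distrib add_ac)
next
  case (coord n f k)
  have [simp]: "real_polynomial_function f" using coord sphere_degree_polynomial by blast
  have "sphere_degree (Suc n) (\<lambda>x. (if i = k then 1 else 0) * f x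
      + x $ k * (sphere_grad i f x + real n * (x $ i * f x)))"
    by (rule sphere_degree.add[OF sphere_degree_Suc[OF sphere_degree_cmult[OF coord.hyps]]
          sphere_degree.coord[OF coord.IH]])
  then show ?case
  proof (rule sphere_degree.cong)
    fix x :: "real^3" assume x: "x \<in> S2"
    have "sphere_grad i (\<lambda>x. x $ k * f x) x = f x * sphere_grad i (\<lambda>x. x $ k) x + x $ k * sphere_grad i f x"
      by (simp add: sphere_grad_def distrib_left sum.distrib sum_distrib_left mult_ac)
    then show "sphere_grad i (\<lambda>x. x $ k * f x) x + real (Suc n) * (x $ i * (x $ k * f x))
        = (if i = k then 1 else 0) * f x + x $ k * (sphere_grad i f x + real n * (x $ i * f x))"
      by (simp only: sphere_grad_coord[OF x]) (simp add: algebra_simps)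
  qed simp
next
  case (cong n f g)
  note p = sphere_degree_polynomial[OF cong.hyps(1)]
  show ?case
    by (rule sphere_degree.cong[OF cong.IH])
      (use cong.hyps p sphere_grad_cong_S2[of g f] in simp_all)
qed

text \<open>Harmonics of degree \<open>n\<close> have eigenvalue - n (n + 1), so the sum in
  parentheses has degree below \<open>n\<close>. The factor x_i expresses this as a bound by
  \<open>n\<close> and avoids truncated subtraction at 0.\<close>

lemma sphere_degree_sphere_laplacian:
  "sphere_degree n f \<Longrightarrow> sphere_degree n (\<lambda>x. x $ i * (sphere_laplacian f x + real n * (real n + 1) * f x))"
proof (induction rule: sphere_degree.induct)
  case (const n c)
  show ?case
  proof (cases n)
    case (Suc m)
    then show ?thesis
      using sphere_degree_cmult[OF sphere_degree_coord[of m i], of "real n * (real n + 1) * c"]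
      by (simp add: sphere_laplacian_def mult_ac)
  qed (simp add: sphere_laplacian_def sphere_degree.const)
next
  case (add n f g)
  have "sphere_degree n (\<lambda>x. x $ i * (sphere_laplacian f x + real n * (real n + 1) * f x)
      + x $ i * (sphere_laplacian g x + real n * (real n + 1) * g x))"
    by (rule sphere_degree.add) (rule add.IH)+
  moreover have "real_polynomial_function f" "real_polynomial_function g"
    using add by (auto intro: sphere_degree_polynomial)
  ultimately show ?case
    by (simp add: sphere_laplacian_def distrib_left sum.distrib add_ac)
next
  case (coord n f k)
  have [simp]: "real_polynomial_function f" using coord sphere_degree_polynomial by blast
  \<comment> \<open>The split comes from \<open>sphere_laplacian_mult\<close> and (n + 1) (n + 2) =
    n (n + 1) + 2 n + 2.\<close>
  have "sphere_degree (Suc n) (\<lambda>x. x $ i * (2 * (sphere_grad k f x + real n * (x $ k * f x)))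
      + x $ k * (x $ i * (sphere_laplacian f x + real n * (real n + 1) * f x)))"
    using coord by (intro sphere_degree.add sphere_degree.coord sphere_degree_cmult sphere_degree_sphere_grad)
  moreover have "x $ i * (sphere_laplacian (\<lambda>x. x $ k * f x) x + real (Suc n) * (real (Suc n) + 1) * (x $ k * f x))
      = x $ i * (2 * (sphere_grad k f x + real n * (x $ k * f x)))
      + x $ k * (x $ i * (sphere_laplacian f x + real n * (real n + 1) * f x))" for x
    by (simp add: sphere_laplacian_mult) (simp add: algebra_simps)
  ultimately show ?case by presburger
next
  case (cong n f g)
  note p = sphere_degree_polynomial[OF cong.hyps(1)]
  show ?case
    by (rule sphere_degree.cong[OF cong.IH])
      (use cong.hyps p sphere_laplacian_cong_S2[of g f] in simp_all)
qed

section \<open>The degree-raising operator\<close>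

definition raise_op :: "3 \<Rightarrow> (real^3 \<Rightarrow> real) \<Rightarrow> real^3 \<Rightarrow> real"
  where "raise_op i f x = (\<Sum>j\<in>UNIV. rot j (poisson (\<lambda>x. x $ i * x $ j) f) x)"

lemma poisson_mult_left:
  assumes "real_polynomial_function f" "real_polynomial_function g" "real_polynomial_function h"
  shows "poisson (\<lambda>x. f x * g x) h = (\<lambda>x. f x * poisson g h x + g x * poisson f h x)"
  using assms by (simp add: poisson_expand fun_eq_iff algebra_simps)

text \<open>The sum of x_j (x \<times> e_j) is x \<times> x = 0.\<close>

lemma rot_coord_sum:
  assumes "real_polynomial_function f"
  shows "(\<Sum>j\<in>UNIV. x $ j * rot j f x) = 0"
  using assms by (simp add: sum_3 rot_expand algebra_simps)

lemma rot_self: "rot j (\<lambda>x. x $ j) x = 0"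
  using exhaust_3[of j] by (auto simp: rot_expand)

text \<open>The inner bracket is x_i \<open>rot j f\<close> + x_j \<open>rot i f\<close>. Applying
  \<open>rot j\<close> to its second summand leaves only x_j \<open>rot j (rot i f)\<close>, and
  these terms cancel in the sum over \<open>j\<close>.\<close>

lemma raise_op_eq:
  assumes [simp]: "real_polynomial_function f"
  shows "raise_op i f x = sphere_grad i f x + x $ i * sphere_laplacian f x"
proof -
  have "rot j (poisson (\<lambda>x. x $ i * x $ j) f) x
      = rot j (\<lambda>x. x $ i) x * rot j f x + x $ i * rot j (rot j f) x + x $ j * rot j (rot i f) x" for j
    by (simp add: poisson_mult_left rot_self flip: rot_def)
  then show ?thesis
    using rot_coord_sum[of "rot i f" x]
    by (simp add: raise_op_def sphere_grad_def sphere_laplacian_def sum.distrib sum_distrib_left)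
qed

text \<open>The coefficient is n + n (n + 1), the sum of the two previous ones. It is nonzero for
  positive \<open>n\<close>, so x_i f can be solved for modulo degree \<open>n\<close>.\<close>

lemma sphere_degree_raise_op:
  assumes f: "sphere_degree n f"
  shows "sphere_degree n (\<lambda>x. raise_op i f x + real n * (real n + 2) * (x $ i * f x))"
proof -
  have "real_polynomial_function f" using f by (rule sphere_degree_polynomial)
  moreover have "sphere_degree n (\<lambda>x. (sphere_grad i f x + real n * (x $ i * f x))
      + x $ i * (sphere_laplacian f x + real n * (real n + 1) * f x))"
    using f by (intro sphere_degree.add sphere_degree_sphere_grad sphere_degree_sphere_laplacian)
  ultimately show ?thesis by (simp add: raise_op_eq algebra_simps)
qed

subsection \<open>Lie subalgebras of algebraic fields\<close>

text \<open>Polynomial representatives of members of \<open>L\<close>, tangent on the sphere only.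
  On them the bracket is the explicit \<open>commutator\<close>.\<close>

definition lifts :: "(real^3 \<Rightarrow> real^3) set \<Rightarrow> (real^3 \<Rightarrow> real^3) set"
  where "lifts L = {P. polynomial_function P \<and> restrict P S2 \<in> L}"

definition hamiltonians :: "(real^3 \<Rightarrow> real^3) set \<Rightarrow> (real^3 \<Rightarrow> real) set"
  where "hamiltonians L = {f. real_polynomial_function f \<and> ham f \<in> lifts L}"

lemma polynomial_function_scaleR:
  "real_polynomial_function f \<Longrightarrow> polynomial_function P \<Longrightarrow> polynomial_function (\<lambda>x. f x *\<^sub>R P x)"
  by (rule polynomial_function_mult) (auto simp: real_polynomial_function_eq)

lemma commutator_scaleR:
  assumes f: "real_polynomial_function f" and P: "polynomial_function P" and Q: "polynomial_function Q"
  shows "commutator P (\<lambda>x. f x *\<^sub>R Q x) x = dir_deriv P f x *\<^sub>R Q x + f x *\<^sub>R commutator P Q x"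
  using f real_polynomial_function_nth[OF Q] real_polynomial_function_nth[OF P]
  by (simp add: vec_eq_iff commutator_def dir_deriv_partial sum_3 algebra_simps)

lemma polynomial_function_G3: "polynomial_function G3"
proof -
  have "polynomial_function (\<lambda>x::real^3. x $ 3 *\<^sub>R x)"
    by (intro polynomial_function_scaleR real_polynomial_function_coord)
      (simp add: polynomial_function_id[unfolded id_def])
  then show ?thesis unfolding G3_def[abs_def] by (intro polynomial_function_diff) auto
qed

context
  fixes L :: "(real^3 \<Rightarrow> real^3) set"
  assumes L: "lie_subalgebra L"
begin

lemma lifts_cong:
  assumes "P \<in> lifts L" "polynomial_function Q" "\<And>x. x \<in> S2 \<Longrightarrow> Q x = P x"
  shows "Q \<in> lifts L"
proof -
  have "restrict Q S2 = restrict P S2" using assms(3) by (rule restrict_ext)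
  then show ?thesis using assms(1,2) by (simp add: lifts_def)
qed

lemma lifts_add:
  assumes "P \<in> lifts L" "Q \<in> lifts L"
  shows "(\<lambda>x. P x + Q x) \<in> lifts L"
proof -
  have "vf_add (restrict P S2) (restrict Q S2) = restrict (\<lambda>x. P x + Q x) S2"
    unfolding vf_add_def by (rule restrict_ext) simp
  moreover have "vf_add (restrict P S2) (restrict Q S2) \<in> L"
    using assms L by (simp add: lifts_def lie_subalgebra_def)
  ultimately show ?thesis
    using assms by (simp add: lifts_def polynomial_function_add)
qed

lemma lifts_scaleR:
  assumes "P \<in> lifts L"
  shows "(\<lambda>x. c *\<^sub>R P x) \<in> lifts L"
proof -
  have "vf_scale c (restrict P S2) = restrict (\<lambda>x. c *\<^sub>R P x) S2"
    unfolding vf_scale_def by (rule restrict_ext) simp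
  moreover have "vf_scale c (restrict P S2) \<in> L"
    using assms L by (simp add: lifts_def lie_subalgebra_def)
  ultimately show ?thesis
    using assms by (simp add: lifts_def polynomial_function_scaleR)
qed

lemma lifts_diff:
  assumes "P \<in> lifts L" "Q \<in> lifts L"
  shows "(\<lambda>x. P x - Q x) \<in> lifts L"
  using lifts_add[OF assms(1) lifts_scaleR[OF assms(2), of "-1"]] by simp

lemma lifts_commutator:
  assumes "P \<in> lifts L" "Q \<in> lifts L"
  shows "commutator P Q \<in> lifts L"
proof -
  have "lie_bracket (restrict P S2) (restrict Q S2) = restrict (commutator P Q) S2"
    using assms L by (intro lie_bracket_restrict) (auto simp: lifts_def lie_subalgebra_def)
  moreover have "lie_bracket (restrict P S2) (restrict Q S2) \<in> L"
    using assms L by (simp add: lifts_def lie_subalgebra_def)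
  ultimately show ?thesis
    using assms by (simp add: lifts_def polynomial_function_commutator)
qed

lemma hamiltonians_cong:
  assumes "f \<in> hamiltonians L" "real_polynomial_function g" "\<And>x. x \<in> S2 \<Longrightarrow> g x = f x"
  shows "g \<in> hamiltonians L"
  unfolding hamiltonians_def
  using assms lifts_cong[of "ham f" "ham g"] ham_cong_S2[of g f]
  by (simp add: hamiltonians_def polynomial_function_ham)

lemma hamiltonians_poisson: "f \<in> hamiltonians L \<Longrightarrow> g \<in> hamiltonians L \<Longrightarrow> poisson f g \<in> hamiltonians L"
  using lifts_commutator[of "ham f" "ham g"] by (simp add: hamiltonians_def commutator_ham)

lemma hamiltonians_add: "f \<in> hamiltonians L \<Longrightarrow> g \<in> hamiltonians L \<Longrightarrow> (\<lambda>x. f x + g x) \<in> hamiltonians L"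
  using lifts_add[of "ham f" "ham g"] by (simp add: hamiltonians_def flip: ham_add)

lemma hamiltonians_cmult:
  assumes "f \<in> hamiltonians L"
  shows "(\<lambda>x. c * f x) \<in> hamiltonians L"
proof -
  have "ham (\<lambda>x. c * f x) = (\<lambda>x. c *\<^sub>R ham f x)"
    using assms by (simp add: fun_eq_iff ham_mult ham_const hamiltonians_def)
  then show ?thesis
    using lifts_scaleR[of "ham f" c] assms by (simp add: hamiltonians_def)
qed

lemma hamiltonians_diff: "f \<in> hamiltonians L \<Longrightarrow> g \<in> hamiltonians L \<Longrightarrow> (\<lambda>x. f x - g x) \<in> hamiltonians L"
  using hamiltonians_add[of f "\<lambda>x. -1 * g x"] hamiltonians_cmult[of g "-1"] by simp

lemma hamiltonians_const: "(\<lambda>x. c) \<in> hamiltonians L"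
proof -
  have "(\<lambda>x\<in>S2. 0) \<in> L" using L by (simp add: lie_subalgebra_def vf_zero_def)
  then show ?thesis by (simp add: hamiltonians_def lifts_def ham_const)
qed

lemma hamiltonians_raise_op:
  assumes lin: "\<And>i. (\<lambda>x. x $ i) \<in> hamiltonians L"
    and quad: "\<And>i j. (\<lambda>x. x $ i * x $ j) \<in> hamiltonians L"
    and f: "f \<in> hamiltonians L"
  shows "raise_op i f \<in> hamiltonians L"
proof -
  have "rot j (poisson (\<lambda>x. x $ i * x $ j) f) \<in> hamiltonians L" for j
    unfolding rot_def by (intro hamiltonians_poisson lin quad f)
  then have "(\<lambda>x. \<Sum>j\<in>UNIV. rot j (poisson (\<lambda>x. x $ i * x $ j) f) x) \<in> hamiltonians L"
    unfolding sum_3 by (intro hamiltonians_add)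
  then show ?thesis by (simp add: raise_op_def[abs_def])
qed

lemma hamiltonians_sphere_degree:
  assumes lin: "\<And>i. (\<lambda>x. x $ i) \<in> hamiltonians L"
    and quad: "\<And>i j. (\<lambda>x. x $ i * x $ j) \<in> hamiltonians L"
  shows "sphere_degree n f \<Longrightarrow> f \<in> hamiltonians L"
proof (induction n arbitrary: f)
  case 0
  then obtain c where "\<forall>x\<in>S2. f x = c" using sphere_degree_0 by blast
  then show ?case using hamiltonians_cong[OF hamiltonians_const] sphere_degree_polynomial[OF 0] by blast
next
  case (Suc n)
  \<comment> \<open>Within one degree the rules \<open>add\<close> and \<open>cong\<close> are
    closure properties; only \<open>coord\<close> reaches down to degree \<open>n\<close>.\<close>
  have "sphere_degree m f \<Longrightarrow> m = Suc n \<Longrightarrow> f \<in> hamiltonians L" for m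
  proof (induction rule: sphere_degree.induct)
    case (const m c)
    show ?case by (rule hamiltonians_const)
  next
    case (add m f g)
    then show ?case using hamiltonians_add[of f g] by blast
  next
    case (cong m f g)
    then show ?case using hamiltonians_cong[of f g] by blast
  next
    case (coord m f k)
    then have f: "sphere_degree n f" by simp
    note p = sphere_degree_polynomial[OF f]
    show ?case
    \<comment> \<open>At 0 the coefficient n (n + 2) vanishes, but x_k f is then a multiple of x_k
      on the sphere.\<close>
    proof (cases "n = 0")
      case True
      then obtain c where c: "\<forall>x\<in>S2. f x = c" using sphere_degree_0[OF f] by blast
      show ?thesis
        by (rule hamiltonians_cong[OF hamiltonians_cmult[OF lin[of k], of c]]) (use c p in simp_all)
    next
      case False
      define a where "a = real n * (real n + 2)"
      have a: "a \<noteq> 0" using False by (simp add: a_def)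
      have "(\<lambda>x. raise_op k f x + a * (x $ k * f x)) \<in> hamiltonians L"
        unfolding a_def by (intro Suc.IH sphere_degree_raise_op f)
      from hamiltonians_cmult[OF hamiltonians_diff[OF this hamiltonians_raise_op[OF lin quad Suc.IH[OF f]]], of "1/a" k]
      show ?thesis using a by simp
    qed
  qed
  then show ?case using Suc.prems by blast
qed

lemma hamiltonians_UNIV:
  assumes "\<And>i. (\<lambda>x. x $ i) \<in> hamiltonians L" "\<And>i j. (\<lambda>x. x $ i * x $ j) \<in> hamiltonians L"
    and "real_polynomial_function f"
  shows "f \<in> hamiltonians L"
  using hamiltonians_sphere_degree[OF assms(1,2)] sphere_degree_exists[OF assms(3)] by blast

section \<open>From Hamiltonian fields to all tangent fields\<close>

lemma lifts_ham_multiples: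
  assumes G3: "G3 \<in> lifts L" and all: "\<And>f. real_polynomial_function f \<Longrightarrow> f \<in> hamiltonians L"
    and f [simp]: "real_polynomial_function f"
  shows "(\<lambda>x. f x *\<^sub>R ham (\<lambda>x. x $ k) x) \<in> lifts L"
proof -
  have ham: "ham f \<in> lifts L" if "real_polynomial_function f" for f
    using all[OF that] by (simp add: hamiltonians_def)
  have 3: "(\<lambda>x. f x *\<^sub>R ham (\<lambda>x. x $ 3) x) \<in> lifts L" if f [simp]: "real_polynomial_function f" for f
  proof -
    \<comment> \<open>On the sphere this difference is 2 x_3 \<open>ham f\<close>.\<close>
    have "(\<lambda>x. commutator G3 (ham f) x - ham (dir_deriv G3 f) x) \<in> lifts L"
      by (intro lifts_diff lifts_commutator G3 ham real_polynomial_function_dir_deriv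
          polynomial_function_G3 f)
    from lifts_scaleR[OF this, of "1/2"] have "(\<lambda>x. x $ 3 *\<^sub>R ham f x) \<in> lifts L"
      by (rule lifts_cong)
        (simp_all add: polynomial_function_scaleR polynomial_function_ham commutator_G3_ham)
    from lifts_diff[OF ham this, of "\<lambda>x. x $ 3 * f x"] show ?thesis
      by (simp add: ham_mult)
  qed
  \<comment> \<open>For k = 3 the first summand is already a lift, so f \<open>ham\<close> {x_j,
    x_3} is one too; {x_2, x_3} = x_1 and {x_1, x_3} = - x_2 give the other two axes.\<close>
  have br: "commutator (ham (\<lambda>x. x $ j)) (\<lambda>x. f x *\<^sub>R ham (\<lambda>x. x $ k) x)
     = (\<lambda>x. rot j f x *\<^sub>R ham (\<lambda>x. x $ k) x + f x *\<^sub>R ham (rot j (\<lambda>x. x $ k)) x)" for j k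
    by (simp add: fun_eq_iff commutator_scaleR polynomial_function_ham commutator_ham rot_def poisson_def)
  have br': "(\<lambda>x. f x *\<^sub>R ham (rot j (\<lambda>x. x $ 3)) x) \<in> lifts L" for j
    using lifts_diff[OF lifts_commutator[OF ham[of "\<lambda>x. x $ j"] 3[OF f]] 3[of "rot j f"]]
    by (simp add: br)
  have "(\<lambda>x. f x *\<^sub>R ham (\<lambda>x. x $ 1) x) \<in> lifts L"
    using br'[of 2] by (simp add: rot_expand)
  moreover have "(\<lambda>x. f x *\<^sub>R ham (\<lambda>x. x $ 2) x) \<in> lifts L"
  proof -
    have "ham (\<lambda>x. - x $ 2) = (\<lambda>x. - ham (\<lambda>x. x $ 2) x)"
      by (simp add: fun_eq_iff vec_eq_iff forall_3 ham_nth)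
    then show ?thesis
      using lifts_scaleR[OF br'[of 1], of "-1"] by (simp add: rot_expand)
  qed
  ultimately show ?thesis using 3[OF f] exhaust_3[of k] by auto
qed

lemma lie_subalgebra_eq_alg_vector_fields:
  assumes G3: "G3 \<in> lifts L" and all: "\<And>f. real_polynomial_function f \<Longrightarrow> f \<in> hamiltonians L"
  shows "L = alg_vector_fields"
proof
  show "L \<subseteq> alg_vector_fields" using L by (simp add: lie_subalgebra_def)
  show "alg_vector_fields \<subseteq> L"
  proof
    fix V assume "V \<in> alg_vector_fields"
    then obtain P where V: "V = restrict P S2" and P: "polynomial_function P"
      and t: "\<And>x. x \<in> S2 \<Longrightarrow> x \<bullet> P x = 0"
      unfolding alg_vector_fields_def by blast
    have q: "\<forall>k. real_polynomial_function (\<lambda>x. cross3 (P x) x $ k)"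
      using real_polynomial_function_nth[OF P] by (simp add: forall_3 cross3_def)
    have "(\<lambda>x. \<Sum>k\<in>UNIV. (cross3 (P x) x $ k) *\<^sub>R ham (\<lambda>x. x $ k) x) \<in> lifts L"
      unfolding sum_3 by (intro lifts_add lifts_ham_multiples[OF G3 all] q[rule_format])
    then have "P \<in> lifts L"
    proof (rule lifts_cong[OF _ P])
      fix x :: "real^3" assume x: "x \<in> S2"
      \<comment> \<open>Since \<open>ham\<close> of x_k is x \<times> e_k, the components of the
        second factor are the required coefficients.\<close>
      have "P x = cross3 x (cross3 (P x) x)"
        using x t[OF x] by (simp add: Lagrange norm_eq_1)
      also have "\<dots> = (\<Sum>k\<in>UNIV. (cross3 (P x) x $ k) *\<^sub>R ham (\<lambda>x. x $ k) x)"
        by (simp add: vec_eq_iff forall_3 sum_3 ham_nth)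
          (simp add: cross3_def)
      finally show "P x = (\<Sum>k\<in>UNIV. (cross3 (P x) x $ k) *\<^sub>R ham (\<lambda>x. x $ k) x)" .
    qed
    then show "V \<in> L" by (simp add: lifts_def V)
  qed
qed

section \<open>Linear and quadratic Hamiltonians and \<open>G3\<close> from the two
  generators\<close>

lemma lie_subalgebra_generators:
  assumes R3: "ham (\<lambda>x. x $ 3) \<in> lifts L"
    and W: "(\<lambda>x. ham (\<lambda>x. x $ 1) x + ham (\<lambda>x. (x $ 1)\<^sup>2 - (x $ 2)\<^sup>2) x + G3 x) \<in> lifts L"
  shows "L = alg_vector_fields"
proof -
  have x3: "(\<lambda>x. x $ 3) \<in> hamiltonians L" using R3 by (simp add: hamiltonians_def)
  define p where "p = (\<lambda>x::real^3. x $ 2 + 4 * (x $ 1 * x $ 2))"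
  \<comment> \<open>Rotation about the third axis commutes with \<open>G3\<close>, so only the
    Hamiltonian part of \<open>W2\<close> contributes.\<close>
  have "commutator (ham (\<lambda>x. x $ 3)) (\<lambda>x. ham (\<lambda>x. x $ 1) x + ham (\<lambda>x. (x $ 1)\<^sup>2 - (x $ 2)\<^sup>2) x + G3 x)
      = ham p"
    unfolding p_def fun_eq_iff
    by (simp add: vec_eq_iff forall_3 commutator_def dir_deriv_partial sum_3 ham_nth G3_nth algebra_simps)
  then have p: "p \<in> hamiltonians L"
    using lifts_commutator[OF R3 W] by (simp add: hamiltonians_def) (simp add: p_def)
  have rot_p: "rot 3 (rot 3 p) = (\<lambda>x. - x $ 2 - 16 * (x $ 1 * x $ 2))"
    by (simp add: p_def rot_expand fun_eq_iff algebra_simps)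
  have rot: "rot j f \<in> hamiltonians L" if "(\<lambda>x. x $ j) \<in> hamiltonians L" "f \<in> hamiltonians L" for j f
    unfolding rot_def using that by (rule hamiltonians_poisson)
  \<comment> \<open>The square of \<open>rot 3\<close> is -1 on x_2 and -4 on x_1 x_2, so p +
    \<open>rot 3 (rot 3 p)\<close> = -12 x_1 x_2.\<close>
  have x12: "(\<lambda>x. x $ 1 * x $ 2) \<in> hamiltonians L"
    using hamiltonians_cmult[OF hamiltonians_add[OF p rot[OF x3 rot[OF x3 p]]], of "-1/12"]
    by (simp add: rot_p) (simp add: p_def algebra_simps)
  have x2: "(\<lambda>x. x $ 2) \<in> hamiltonians L"
    using hamiltonians_diff[OF p hamiltonians_cmult[OF x12, of 4]] by (simp add: p_def)
  have x1: "(\<lambda>x. x $ 1) \<in> hamiltonians L"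
    using hamiltonians_cmult[OF rot[OF x3 x2], of "-1"] by (simp add: rot_expand)
  have lin: "(\<lambda>x. x $ i) \<in> hamiltonians L" for i
    using x1 x2 x3 exhaust_3[of i] by auto
  have x13: "(\<lambda>x. x $ 1 * x $ 3) \<in> hamiltonians L"
    using rot[OF x1 x12] by (simp add: rot_expand mult.commute)
  have x23: "(\<lambda>x. x $ 2 * x $ 3) \<in> hamiltonians L"
    using hamiltonians_cmult[OF rot[OF x2 x12], of "-1"] by (simp add: rot_expand mult.commute)
  have d12: "(\<lambda>x. x $ 2 * x $ 2 - x $ 1 * x $ 1) \<in> hamiltonians L"
    using rot[OF x3 x12] by (simp add: rot_expand)
  have d23: "(\<lambda>x. x $ 3 * x $ 3 - x $ 2 * x $ 2) \<in> hamiltonians L"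
    using rot[OF x1 x23] by (simp add: rot_expand)
  \<comment> \<open>Brackets gave only differences of squares; the constant 1 = x . x supplies the
    missing relation.\<close>
  have x22: "(\<lambda>x. x $ 2 * x $ 2) \<in> hamiltonians L"
  proof (rule hamiltonians_cong[OF hamiltonians_cmult[OF hamiltonians_diff[OF hamiltonians_add[OF hamiltonians_const d12] d23]]])
    show "x $ 2 * x $ 2 = 1/3 * (1 + (x $ 2 * x $ 2 - x $ 1 * x $ 1) - (x $ 3 * x $ 3 - x $ 2 * x $ 2))"
      if "x \<in> S2" for x :: "real^3"
      using norm_S2[OF that] by simp
  qed simp
  have x11: "(\<lambda>x. x $ 1 * x $ 1) \<in> hamiltonians L" using hamiltonians_diff[OF x22 d12] by simp
  have x33: "(\<lambda>x. x $ 3 * x $ 3) \<in> hamiltonians L" using hamiltonians_add[OF d23 x22] by simp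
  have quad: "(\<lambda>x. x $ i * x $ j) \<in> hamiltonians L" for i j
  proof -
    have "\<forall>i j. (\<lambda>x. x $ i * x $ j) \<in> hamiltonians L"
      using x11 x12 x13 x22 x23 x33
      by (simp add: forall_3 mult.commute[of "_ $ 2" "_ $ 1"] mult.commute[of "_ $ 3" "_ $ 1"]
          mult.commute[of "_ $ 3" "_ $ 2"])
    then show ?thesis by blast
  qed
  note all = hamiltonians_UNIV[OF lin quad]
  have "ham f \<in> lifts L" if "real_polynomial_function f" for f
    using all[OF that] by (simp add: hamiltonians_def)
  note h = this[of "\<lambda>x. x $ 1"] this[of "\<lambda>x. (x $ 1)\<^sup>2 - (x $ 2)\<^sup>2"]
  \<comment> \<open>With all Hamiltonian fields in \<open>L\<close>, the first two summands of the
    second generator can be subtracted.\<close>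
  have "G3 \<in> lifts L"
    using lifts_diff[OF W lifts_add[OF h]] by simp
  then show ?thesis using all by (rule lie_subalgebra_eq_alg_vector_fields)
qed

end

section \<open>Polynomial lifts of \<open>X_field\<close> and \<open>G_field\<close>, and the
  conclusion\<close>

lemma gradient_eq_grad:
  assumes "real_polynomial_function f"
  shows "gradient f x = grad f x"
proof (rule gradient_eqI)
  note d = real_polynomial_function_has_derivative[OF assms, of x]
  have "bounded_linear (frechet_derivative f (at x))"
    using d has_derivative_bounded_linear by blast
  have "frechet_derivative f (at x) = (\<lambda>h. h \<bullet> grad f x)"
    by (rule ext, subst linear_functional_sum[OF \<open>bounded_linear _\<close>])
      (simp add: grad_def partial_def inner_vec_def mult.commute)
  then show "GDERIV f x :> grad f x" using d by (simp add: gderiv_def)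
qed

lemma X_field_ham: "real_polynomial_function f \<Longrightarrow> X_field f = restrict (ham f) S2"
  unfolding X_field_def by (rule restrict_ext) (simp add: ham_def gradient_eq_grad)

lemma G_field_coord_3: "G_field (\<lambda>x. x $ 3) = restrict G3 S2"
proof -
  have "gradient (\<lambda>x. x $ 3) x = axis 3 1" for x
    by (simp add: gradient_eq_grad grad_def vec_eq_iff axis_def)
  then show ?thesis
    unfolding G_field_def by (intro restrict_ext) (simp add: G3_def inner_axis)
qed

theorem theorem1:
  fixes W1 W2 :: "real^3 \<Rightarrow> real^3"
  assumes "W1 = X_field (\<lambda>x. x $ 3)"
    and "W2 = vf_add (vf_add (X_field (\<lambda>x. x $ 1)) (X_field (\<lambda>x. (x $ 1)\<^sup>2 - (x $ 2)\<^sup>2)))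
                     (G_field (\<lambda>x. x $ 3))"
  shows "lie_generated {W1, W2} = alg_vector_fields"
proof -
  let ?W = "\<lambda>x. ham (\<lambda>x. x $ 1) x + ham (\<lambda>x. (x $ 1)\<^sup>2 - (x $ 2)\<^sup>2) x + G3 x"
  have W1: "W1 = restrict (ham (\<lambda>x. x $ 3)) S2"
    by (simp add: assms(1) X_field_ham)
  have W2: "W2 = restrict ?W S2"
    unfolding assms(2) vf_add_def by (rule restrict_ext) (simp add: X_field_ham G_field_coord_3)
  have pW: "polynomial_function ?W"
    by (rule polynomial_function_add[OF polynomial_function_add[OF polynomial_function_ham
            polynomial_function_ham] polynomial_function_G3]) simp_all
  have "x \<bullet> G3 x = 0" if "x \<in> S2" for x
    using that by (simp add: G3_def inner_diff_right norm_eq_1 inner_axis)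
  then have tW: "\<forall>x\<in>S2. x \<bullet> ?W x = 0"
    by (simp add: inner_add_right ham_tangent)
  have "W1 \<in> alg_vector_fields"
    unfolding W1 alg_vector_fields_def
    using polynomial_function_ham[of "\<lambda>x. x $ 3"] ham_tangent by blast
  moreover have "W2 \<in> alg_vector_fields"
    unfolding W2 alg_vector_fields_def using pW tW by blast
  ultimately have "{W1, W2} \<subseteq> alg_vector_fields" by simp
  then have "lie_subalgebra (lie_generated {W1, W2})"
    by (rule lie_subalgebra_lie_generated)
  moreover have "W1 \<in> lie_generated {W1, W2}" "W2 \<in> lie_generated {W1, W2}"
    unfolding lie_generated_def by (simp_all add: hull_inc)
  then have "ham (\<lambda>x. x $ 3) \<in> lifts (lie_generated {W1, W2})" "?W \<in> lifts (lie_generated {W1, W2})"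
    using pW by (simp_all add: lifts_def polynomial_function_ham W1 W2)
  ultimately show ?thesis by (rule lie_subalgebra_generators)
qed

end
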